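(* Let $C\subset\mathbb{R}^n$ be nonempty, closed and convex and let $D=\{x\in\mathbb{R}^n: Ax=b\}$ be a nonempty affine set, where $A$ is a linear operator. Suppose that $\alpha_1,\alpha_2\in(0,2]$ and $\alpha_1\ne1$. Then the set of stationary points $\{x\in\mathbb{R}^n:\nabla F_{\alpha_1,\alpha_2}^{\mathrm{GAP}}(x)=0\}$ of the GAP envelope (defined in the context) is the fixed-point set $\{x\in\mathbb{R}^n:P_C^{\alpha_2}P_D^{\alpha_1}x=x\}$ of $P_C^{\alpha_2}P_D^{\alpha_1}$.
   Context: $\langle\cdot,\cdot\rangle$ is an inner product on $\mathbb{R}^n$ with induced norm $\|\cdot\|$; $\Pi_C$ is the projection onto a nonempty closed convex set $C$ and $\iota_C$ its indicator function. Put $r_C(x)=\iota_C(x)+\tfrac12\|x\|^2$, with conjugate $r_C^*(y)=\sup_x\{\langle y,x\rangle-r_C(x)\}$, for which $\nabla r_C^*=\Pi_C$. Define $p_C^\alpha(x)=\alpha r_C^*(x)+\tfrac{1-\alpha}2\|x\|^2$ and the relaxed projection $P_C^\alpha(x)=\nabla p_C^\alpha(x)=\alpha\Pi_C(x)+(1-\alpha)x$. For the affine set $D=\{x:Ax=b\}$ let $N=\Pi_{D_0}$ with $D_0=\{x:Ax=0\}$, and let $P=(1-\alpha_1)\mathrm{Id}+\alpha_1N$ (the linear part of the affine map $P_D^{\alpha_1}$). The GAP (generalized alternating projections) envelope is $$F_{\alpha_1,\alpha_2}^{\mathrm{GAP}}(x)=\tfrac12\langle Px,x\rangle-p_C^{\alpha_2}(P_D^{\alpha_1}x).$$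 *)

theory Defs
  imports "HOL-Analysis.Analysis"
begin

text \<open>The indicator function of convex analysis: \<open>0\<close> on the set and \<open>\<infinity>\<close> outside
  (not the 0/1-valued \<open>indicator\<close> of the library).\<close>

definition convex_indicator :: "'a set \<Rightarrow> 'a \<Rightarrow> ereal" where
  "convex_indicator C x = (if x \<in> C then 0 else \<infinity>)"

definition conjugate :: "('a::euclidean_space \<Rightarrow> ereal) \<Rightarrow> 'a \<Rightarrow> ereal" where
  "conjugate f y = (SUP x. ereal (y \<bullet> x) - f x)"

definition r_fun :: "'a::euclidean_space set \<Rightarrow> 'a \<Rightarrow> ereal" where
  "r_fun C x = convex_indicator C x + ereal (1/2 * (norm x)\<^sup>2)"

text \<open>The conjugate of \<open>r_fun C\<close> is finite everywhere if \<open>C\<close> is nonempty, so the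
  coercion \<open>real_of_ereal\<close> in \<open>p_fun\<close> below loses nothing.\<close>

lemma conjugate_r_fun_finite:
  fixes C :: "'a::euclidean_space set"
  assumes "C \<noteq> {}"
  shows "\<bar>conjugate (r_fun C) y\<bar> \<noteq> \<infinity>"
proof -
  obtain c where c: "c \<in> C" using assms by blast
  have up: "conjugate (r_fun C) y \<le> ereal (1/2 * (norm y)\<^sup>2)"
    unfolding conjugate_def
  proof (rule SUP_least)
    fix x :: 'a
    have "0 \<le> (y - x) \<bullet> (y - x)" by simp
    then have "y \<bullet> x - 1/2 * (norm x)\<^sup>2 \<le> 1/2 * (norm y)\<^sup>2"
      by (simp add: power2_norm_eq_inner inner_diff inner_commute)
    then show "ereal (y \<bullet> x) - r_fun C x \<le> ereal (1/2 * (norm y)\<^sup>2)"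
      by (simp add: r_fun_def convex_indicator_def)
  qed
  have "ereal (y \<bullet> c) - r_fun C c \<le> conjugate (r_fun C) y"
    unfolding conjugate_def by (rule SUP_upper) simp
  then have "ereal (y \<bullet> c - 1/2 * (norm c)\<^sup>2) \<le> conjugate (r_fun C) y"
    using c by (simp add: r_fun_def convex_indicator_def)
  with up show ?thesis by auto
qed

definition p_fun :: "real \<Rightarrow> 'a::euclidean_space set \<Rightarrow> 'a \<Rightarrow> real" where
  "p_fun \<alpha> C x = \<alpha> * real_of_ereal (conjugate (r_fun C) x) + (1 - \<alpha>) / 2 * (norm x)\<^sup>2"

definition relaxed_proj :: "real \<Rightarrow> 'a::euclidean_space set \<Rightarrow> 'a \<Rightarrow> 'a" where
  "relaxed_proj \<alpha> C x = \<alpha> *\<^sub>R closest_point C x + (1 - \<alpha>) *\<^sub>R x"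

definition proj_linear_part :: "real \<Rightarrow> ('a::euclidean_space \<Rightarrow> 'b::real_vector) \<Rightarrow> 'a \<Rightarrow> 'a" where
  "proj_linear_part \<alpha> A x = (1 - \<alpha>) *\<^sub>R x + \<alpha> *\<^sub>R closest_point {z. A z = 0} x"

definition gap_envelope ::
    "real \<Rightarrow> real \<Rightarrow> 'a::euclidean_space set \<Rightarrow> ('a \<Rightarrow> 'b::real_vector) \<Rightarrow> 'b \<Rightarrow> 'a \<Rightarrow> real" where
  "gap_envelope \<alpha>\<^sub>1 \<alpha>\<^sub>2 C A b x =
     1/2 * (proj_linear_part \<alpha>\<^sub>1 A x \<bullet> x) - p_fun \<alpha>\<^sub>2 C (relaxed_proj \<alpha>\<^sub>1 {z. A z = b} x)"

end

theory Submission
  imports Defs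
begin

text \<open>The envelope is differentiable with gradient \<open>P (x - P\<^sub>C (P\<^sub>D x))\<close>: the conjugate of
  \<open>r\<^sub>C\<close> has gradient \<open>\<Pi>\<^sub>C\<close>, and \<open>P\<^sub>D\<close> is affine with self-adjoint linear part \<open>P\<close>. Since \<open>P\<close>
  is the identity on the kernel of \<open>A\<close> and multiplication by \<open>1 - \<alpha>\<^sub>1 \<noteq> 0\<close> on its orthogonal
  complement, it is injective, so the gradient vanishes exactly at the fixed points.\<close>

section \<open>Gradient of the conjugate of \<open>r_fun C\<close> and of
  \<open>p_fun\<close>\<close>

text \<open>Completing the square turns the objective on \<open>C\<close> into half of |y|^2 - |y -
  x|^2, so maximising it means minimising the distance to \<open>y\<close>; the nearest point
  attains the supremum.\<close>

lemma conjugate_r_fun_eq: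
  fixes C :: "'a::euclidean_space set"
  assumes "closed C" and "C \<noteq> {}"
  shows "conjugate (r_fun C) y
    = ereal (y \<bullet> closest_point C y - 1/2 * (norm (closest_point C y))\<^sup>2)"
  unfolding conjugate_def
proof (rule antisym)
  show "(SUP x. ereal (y \<bullet> x) - r_fun C x)
      \<le> ereal (y \<bullet> closest_point C y - 1/2 * (norm (closest_point C y))\<^sup>2)"
  proof (rule SUP_least)
    fix x
    show "ereal (y \<bullet> x) - r_fun C x
        \<le> ereal (y \<bullet> closest_point C y - 1/2 * (norm (closest_point C y))\<^sup>2)"
    proof (cases "x \<in> C")
      case True
      then have "norm (y - closest_point C y) \<le> norm (y - x)"
        using closest_point_le[OF assms(1), of x y] by (simp add: dist_norm)
      then have "(norm (y - closest_point C y))\<^sup>2 \<le> (norm (y - x))\<^sup>2"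
        by (simp add: power_mono)
      with True show ?thesis
        by (simp add: r_fun_def convex_indicator_def power2_norm_eq_inner inner_diff inner_commute)
    qed (simp add: r_fun_def convex_indicator_def)
  qed
  have "closest_point C y \<in> C"
    using assms by (rule closest_point_in_set)
  then have "ereal (y \<bullet> closest_point C y) - r_fun C (closest_point C y)
      = ereal (y \<bullet> closest_point C y - 1/2 * (norm (closest_point C y))\<^sup>2)"
    by (simp add: r_fun_def convex_indicator_def)
  then show "ereal (y \<bullet> closest_point C y - 1/2 * (norm (closest_point C y))\<^sup>2)
      \<le> (SUP x. ereal (y \<bullet> x) - r_fun C x)"
    using SUP_upper[of "closest_point C y" UNIV "\<lambda>x. ereal (y \<bullet> x) - r_fun C x"] by simp
qed

text \<open>The Fenchel-Young inequality for \<open>r_fun C\<close>, stated over the reals so that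
  it serves as a subgradient inequality below.\<close>

lemma real_conjugate_r_fun_ge:
  fixes C :: "'a::euclidean_space set"
  assumes "closed C" and "c \<in> C"
  shows "y \<bullet> c - 1/2 * (norm c)\<^sup>2 \<le> real_of_ereal (conjugate (r_fun C) y)"
proof -
  have "C \<noteq> {}" using assms(2) by blast
  have "ereal (y \<bullet> c) - r_fun C c \<le> conjugate (r_fun C) y"
    unfolding conjugate_def by (rule SUP_upper) simp
  then show ?thesis
    using assms by (simp add: conjugate_r_fun_eq[OF assms(1) \<open>C \<noteq> {}\<close>] r_fun_def convex_indicator_def)
qed

text \<open>Two uses of Fenchel-Young trap the first-order remainder between 0 and (z - y) . (\<Pi>
  z - \<Pi> y). Projections are nonexpansive, so the remainder is at most |z - y|^2.\<close>

lemma has_derivative_conjugate_r_fun: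
  fixes C :: "'a::euclidean_space set"
  assumes "convex C" and "closed C" and "C \<noteq> {}"
  shows "((\<lambda>y. real_of_ereal (conjugate (r_fun C) y))
    has_derivative (\<lambda>h. h \<bullet> closest_point C y)) (at y)"
\<comment> \<open>The bound holds for every \<open>z\<close>, so the radius 1 is an arbitrary
  choice.\<close>
proof (rule has_derivativeI_sandwich[where e = 1 and H = "\<lambda>z. norm (z - y)"])
  let ?g = "\<lambda>y. real_of_ereal (conjugate (r_fun C) y)" and ?\<Pi> = "closest_point C"
  show "((\<lambda>z. norm (z - y)) \<longlongrightarrow> 0) (at y)"
    by (auto intro!: tendsto_eq_intros)
  show "bounded_linear (\<lambda>h. h \<bullet> ?\<Pi> y)"
    by (rule bounded_linear_inner_left)
  fix z assume "z \<noteq> y"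
  have g: "?g u = u \<bullet> ?\<Pi> u - 1/2 * (norm (?\<Pi> u))\<^sup>2" for u
    using assms by (simp add: conjugate_r_fun_eq)
  \<comment> \<open>Fenchel-Young at \<open>z\<close> with the point \<open>?\<Pi> y\<close>, which
    attains equality at \<open>y\<close>.\<close>
  have lower: "0 \<le> ?g z - ?g y - (z - y) \<bullet> ?\<Pi> y"
    using real_conjugate_r_fun_ge[OF assms(2) closest_point_in_set[OF assms(2,3), of y], of z]
    unfolding g[of y] by (simp add: inner_diff)
  \<comment> \<open>The same inequality with the roles of \<open>y\<close> and \<open>z\<close>
    exchanged.\<close>
  have "?g z - ?g y - (z - y) \<bullet> ?\<Pi> y \<le> (z - y) \<bullet> (?\<Pi> z - ?\<Pi> y)"
    using real_conjugate_r_fun_ge[OF assms(2) closest_point_in_set[OF assms(2,3), of z], of y]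
    unfolding g[of z] by (simp add: inner_diff)
  also have "\<dots> \<le> norm (z - y) * norm (?\<Pi> z - ?\<Pi> y)"
    by (rule norm_cauchy_schwarz)
  also have "\<dots> \<le> norm (z - y) * norm (z - y)"
    using closest_point_lipschitz[OF assms, of z y] by (intro mult_left_mono) (auto simp: dist_norm)
  finally show "norm (?g z - ?g y - (z - y) \<bullet> ?\<Pi> y) / norm (z - y) \<le> norm (z - y)"
    using lower \<open>z \<noteq> y\<close> by (simp add: pos_divide_le_eq)
qed simp

lemma has_derivative_p_fun:
  fixes C :: "'a::euclidean_space set"
  assumes "convex C" and "closed C" and "C \<noteq> {}"
  shows "(p_fun \<alpha> C has_derivative (\<lambda>h. h \<bullet> relaxed_proj \<alpha> C y)) (at y)"
proof -
  have "((\<lambda>x. \<alpha> * real_of_ereal (conjugate (r_fun C) x) + (1 - \<alpha>) / 2 * (x \<bullet> x)) has_derivative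
      (\<lambda>h. \<alpha> * (h \<bullet> closest_point C y) + (1 - \<alpha>) / 2 * (y \<bullet> h + h \<bullet> y))) (at y)"
    by (intro has_derivative_add has_derivative_mult_right has_derivative_inner
        has_derivative_ident has_derivative_conjugate_r_fun[OF assms])
  moreover have "\<alpha> * (h \<bullet> closest_point C y) + (1 - \<alpha>) / 2 * (y \<bullet> h + h \<bullet> y)
      = h \<bullet> relaxed_proj \<alpha> C y" for h
    by (simp add: relaxed_proj_def inner_add_right inner_commute[of y h])
  ultimately have "((\<lambda>x. \<alpha> * real_of_ereal (conjugate (r_fun C) x) + (1 - \<alpha>) / 2 * (x \<bullet> x))
      has_derivative (\<lambda>h. h \<bullet> relaxed_proj \<alpha> C y)) (at y)"
    by simp
  then show ?thesis
    by (simp add: p_fun_def[abs_def] power2_norm_eq_inner)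
qed

section \<open>Projection onto a subspace\<close>

lemma closest_point_in_subspace:
  fixes S :: "'a::euclidean_space set"
  assumes "subspace S"
  shows "closest_point S x \<in> S"
  using closed_subspace[OF assms] subspace_0[OF assms] by (auto intro: closest_point_in_set)

text \<open>The variational inequality of the projection, tested at \<open>?p + w\<close> and at
  \<open>?p - w\<close>, bounds the inner product by 0 from both sides.\<close>

lemma closest_point_subspace_orthogonal:
  fixes S :: "'a::euclidean_space set"
  assumes "subspace S" and "w \<in> S"
  shows "(x - closest_point S x) \<bullet> w = 0"
proof -
  have S: "convex S" "closed S"
    using assms by (auto simp: subspace_imp_convex closed_subspace)
  let ?p = "closest_point S x"
  have "?p + w \<in> S" "?p - w \<in> S"
    using assms closest_point_in_subspace by (auto intro: subspace_add subspace_diff)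
  from closest_point_dot[OF S this(1), of x] closest_point_dot[OF S this(2), of x]
  show ?thesis by (simp add: inner_diff_right)
qed

text \<open>The difference of the two points lies in \<open>S\<close> and is orthogonal to
  \<open>S\<close>, hence to itself. Linearity of the projection follows by checking this criterion
  for the obvious candidates.\<close>

lemma closest_point_subspace_eqI:
  fixes S :: "'a::euclidean_space set"
  assumes "subspace S" and "u \<in> S" and orth: "\<And>w. w \<in> S \<Longrightarrow> (x - u) \<bullet> w = 0"
  shows "closest_point S x = u"
proof -
  have d: "closest_point S x - u \<in> S"
    using assms by (intro subspace_diff closest_point_in_subspace)
  have "(closest_point S x - u) \<bullet> (closest_point S x - u) = 0"
    using orth[OF d] closest_point_subspace_orthogonal[OF assms(1) d, of x]
    by (simp add: inner_diff_left)
  then show ?thesis by simp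
qed

lemma linear_closest_point_subspace:
  fixes S :: "'a::euclidean_space set"
  assumes "subspace S"
  shows "linear (closest_point S)"
proof (rule linearI)
  fix x y
  show "closest_point S (x + y) = closest_point S x + closest_point S y"
  proof (rule closest_point_subspace_eqI[OF assms])
    show "closest_point S x + closest_point S y \<in> S"
      by (simp add: assms closest_point_in_subspace subspace_add)
    fix w assume "w \<in> S"
    from closest_point_subspace_orthogonal[OF assms this, of x]
      closest_point_subspace_orthogonal[OF assms this, of y]
    show "(x + y - (closest_point S x + closest_point S y)) \<bullet> w = 0"
      by (simp add: inner_diff_left inner_add_left)
  qed
next
  fix r x
  show "closest_point S (r *\<^sub>R x) = r *\<^sub>R closest_point S x"
  proof (rule closest_point_subspace_eqI[OF assms])
    show "r *\<^sub>R closest_point S x \<in> S"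
      by (simp add: assms closest_point_in_subspace subspace_scale)
    fix w assume "w \<in> S"
    from closest_point_subspace_orthogonal[OF assms this, of x]
    show "(r *\<^sub>R x - r *\<^sub>R closest_point S x) \<bullet> w = 0"
      by (simp add: inner_diff_left)
  qed
qed

text \<open>The residual of \<open>x\<close> is orthogonal to the projection of \<open>y\<close>.
  Exchanging \<open>x\<close> and \<open>y\<close> yields self-adjointness; taking
  \<open>y = x\<close> evaluates x . N x as |N x|^2.\<close>

lemma closest_point_subspace_inner:
  fixes S :: "'a::euclidean_space set"
  assumes "subspace S"
  shows "closest_point S x \<bullet> closest_point S y = x \<bullet> closest_point S y"
  using closest_point_subspace_orthogonal[OF assms closest_point_in_subspace[OF assms, of y], of x]
  by (simp add: inner_diff_left)

section \<open>The linear part of the relaxed projection onto the affine set\<close>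

lemma linear_proj_linear_part:
  assumes "linear A"
  shows "linear (proj_linear_part \<alpha> A)"
  unfolding proj_linear_part_def[abs_def]
  by (intro linear_compose_add linear_compose_scale_right linear_ident
      linear_closest_point_subspace linear_subspace_kernel[OF assms])

lemma proj_linear_part_self_adjoint:
  assumes "linear A"
  shows "proj_linear_part \<alpha> A x \<bullet> y = x \<bullet> proj_linear_part \<alpha> A y"
  using closest_point_subspace_inner[OF linear_subspace_kernel[OF assms], of x y]
    closest_point_subspace_inner[OF linear_subspace_kernel[OF assms], of y x]
  by (simp add: proj_linear_part_def inner_add inner_commute)

lemma proj_linear_part_eq_0_iff:
  assumes "linear A" and "\<alpha> \<noteq> 1"
  shows "proj_linear_part \<alpha> A x = 0 \<longleftrightarrow> x = 0"
proof
  let ?N = "closest_point {z. A z = 0}"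
  assume zero: "proj_linear_part \<alpha> A x = 0"
  \<comment> \<open>Pairing with \<open>?N x\<close> isolates the kernel component, whose
    coefficient is (1 - \<alpha>) + \<alpha> = 1. Once it vanishes, only (1 - \<alpha>) x = 0
    remains, and \<alpha> differs from 1.\<close>
  have "proj_linear_part \<alpha> A x \<bullet> ?N x = ?N x \<bullet> ?N x"
    using closest_point_subspace_inner[OF linear_subspace_kernel[OF assms(1)], of x x]
    by (simp add: proj_linear_part_def inner_add_left algebra_simps)
  then have "?N x = 0"
    using zero by simp
  with zero show "x = 0"
    using assms(2) by (simp add: proj_linear_part_def)
qed (simp add: linear_0 linear_proj_linear_part assms)

section \<open>Projection onto the affine set\<close>

lemma closest_point_translation:
  fixes S :: "'a::euclidean_space set"
  assumes "convex S" and "closed S" and "S \<noteq> {}"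
  shows "closest_point ((+) d ` S) (d + x) = d + closest_point S x"
proof (rule closest_point_unique[symmetric])
  show "convex ((+) d ` S)" "closed ((+) d ` S)"
    using assms by (simp_all add: convex_translation closed_translation)
  show "d + closest_point S x \<in> (+) d ` S"
    using assms by (simp add: closest_point_in_set)
  show "\<forall>z \<in> (+) d ` S. dist (d + x) (d + closest_point S x) \<le> dist (d + x) z"
    using assms by (auto simp: closest_point_le)
qed

lemma closest_point_affine_eq:
  fixes A :: "'a::euclidean_space \<Rightarrow> 'b::real_vector"
  assumes "linear A" and "A d = b"
  shows "closest_point {z. A z = b} x = d + closest_point {z. A z = 0} (x - d)"
proof -
  have "{z. A z = b} = (+) d ` {z. A z = 0}"
  proof (intro set_eqI iffI)
    fix z assume "z \<in> {z. A z = b}"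
    then show "z \<in> (+) d ` {z. A z = 0}"
      using assms by (intro image_eqI[of _ _ "z - d"]) (simp_all add: linear_diff)
  qed (use assms in \<open>auto simp: linear_add\<close>)
  moreover have "subspace {z. A z = 0}"
    using assms(1) by (rule linear_subspace_kernel)
  then have "closest_point ((+) d ` {z. A z = 0}) (d + (x - d)) = d + closest_point {z. A z = 0} (x - d)"
    using subspace_0 by (intro closest_point_translation subspace_imp_convex closed_subspace) auto
  ultimately show ?thesis by simp
qed

text \<open>Isolates a constant term, so that the derivative can be read off. Here d - N d is the
  point of the affine set nearest to the origin.\<close>

lemma relaxed_proj_affine_eq:
  fixes A :: "'a::euclidean_space \<Rightarrow> 'b::real_vector"
  assumes "linear A" and "A d = b"
  shows "relaxed_proj \<alpha> {z. A z = b} x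
    = proj_linear_part \<alpha> A x + \<alpha> *\<^sub>R (d - closest_point {z. A z = 0} d)"
proof -
  have eq: "closest_point {z. A z = 0} (x - d) = closest_point {z. A z = 0} x - closest_point {z. A z = 0} d"
    by (intro linear_diff linear_closest_point_subspace linear_subspace_kernel assms(1))
  show ?thesis
    unfolding relaxed_proj_def proj_linear_part_def closest_point_affine_eq[OF assms] eq
    by (simp add: algebra_simps)
qed

section \<open>Gradient of the envelope and its zeros\<close>

lemma gderiv_gap_envelope:
  fixes C :: "'a::euclidean_space set" and A :: "'a \<Rightarrow> 'b::real_vector"
  assumes "convex C" "closed C" "C \<noteq> {}" and "linear A" and "A d = b"
  shows "GDERIV (gap_envelope \<alpha>\<^sub>1 \<alpha>\<^sub>2 C A b) x :>
    proj_linear_part \<alpha>\<^sub>1 A (x - relaxed_proj \<alpha>\<^sub>2 C (relaxed_proj \<alpha>\<^sub>1 {z. A z = b} x))"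
proof -
  let ?P = "proj_linear_part \<alpha>\<^sub>1 A" and ?R = "relaxed_proj \<alpha>\<^sub>1 {z. A z = b}"
  let ?q = "relaxed_proj \<alpha>\<^sub>2 C (?R x)"
  have P: "(?P has_derivative ?P) (at x)"
    using linear_proj_linear_part[OF assms(4)]
    by (intro bounded_linear_imp_has_derivative) (simp add: linear_linear)
  have "(?R has_derivative ?P) (at x)"
    unfolding relaxed_proj_affine_eq[OF assms(4,5), abs_def]
    by (rule has_derivative_add_const[OF P])
  from has_derivative_compose[OF this has_derivative_p_fun[OF assms(1-3)]]
  have p: "((\<lambda>x. p_fun \<alpha>\<^sub>2 C (?R x)) has_derivative (\<lambda>h. ?P h \<bullet> ?q)) (at x)" .
  have "((\<lambda>x. 1/2 * (?P x \<bullet> x) - p_fun \<alpha>\<^sub>2 C (?R x)) has_derivative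
      (\<lambda>h. 1/2 * (?P x \<bullet> h + ?P h \<bullet> x) - ?P h \<bullet> ?q)) (at x)"
    by (intro has_derivative_diff has_derivative_mult_right has_derivative_inner P p
        has_derivative_ident)
  \<comment> \<open>Self-adjointness moves \<open>?P\<close> off \<open>h\<close>: the two halves of
    the quadratic term merge into h . P x, and the chain-rule term becomes h . P q.\<close>
  moreover have "1/2 * (?P x \<bullet> h + ?P h \<bullet> x) - ?P h \<bullet> ?q = h \<bullet> ?P (x - ?q)" for h
    by (simp add: proj_linear_part_self_adjoint[OF assms(4), of _ h] inner_commute[of "?P x" h]
        linear_diff[OF linear_proj_linear_part[OF assms(4)]] inner_diff_right)
  ultimately show ?thesis
    by (simp add: gderiv_def gap_envelope_def[abs_def])
qed

theorem proposition5p1: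
  fixes C :: "'a::euclidean_space set"
    and A :: "'a \<Rightarrow> 'b::real_vector"
    and b :: 'b
    and \<alpha>\<^sub>1 \<alpha>\<^sub>2 :: real
  assumes "C \<noteq> {}" and "closed C" and "convex C"
    and "linear A"
    and "{x. A x = b} \<noteq> {}"
    and "\<alpha>\<^sub>1 \<in> {0<..2}" and "\<alpha>\<^sub>2 \<in> {0<..2}" and "\<alpha>\<^sub>1 \<noteq> 1"
  shows "{x. GDERIV (gap_envelope \<alpha>\<^sub>1 \<alpha>\<^sub>2 C A b) x :> 0}
       = {x. relaxed_proj \<alpha>\<^sub>2 C (relaxed_proj \<alpha>\<^sub>1 {z. A z = b} x) = x}"
proof -
  obtain d where "A d = b"
    using assms(5) by blast
  let ?G = "\<lambda>x. proj_linear_part \<alpha>\<^sub>1 A (x - relaxed_proj \<alpha>\<^sub>2 C (relaxed_proj \<alpha>\<^sub>1 {z. A z = b} x))"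
  have G: "GDERIV (gap_envelope \<alpha>\<^sub>1 \<alpha>\<^sub>2 C A b) x :> ?G x" for x
    using assms \<open>A d = b\<close> by (intro gderiv_gap_envelope)
  \<comment> \<open>The envelope is differentiable everywhere with gradient \<open>?G x\<close>, so
    by uniqueness of derivatives stationarity is an equation for \<open>?G x\<close>.\<close>
  have "GDERIV (gap_envelope \<alpha>\<^sub>1 \<alpha>\<^sub>2 C A b) x :> 0 \<longleftrightarrow> ?G x = 0" for x
  proof
    assume "GDERIV (gap_envelope \<alpha>\<^sub>1 \<alpha>\<^sub>2 C A b) x :> 0"
    then have "(\<lambda>h. h \<bullet> 0) = (\<lambda>h. h \<bullet> ?G x)"
      using G[of x] unfolding gderiv_def by (rule has_derivative_unique)
    \<comment> \<open>Evaluating both functionals at h = \<open>?G x\<close> gives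
      |\<open>?G x\<close>|^2 = 0.\<close>
    then show "?G x = 0"
      by (metis inner_eq_zero_iff inner_zero_right)
  qed (use G[of x] in simp)
  \<comment> \<open>Injectivity of the linear part strips it from the gradient; this is where
    \<open>\<alpha>\<^sub>1 \<noteq> 1\<close> enters.\<close>
  also have "?G x = 0 \<longleftrightarrow> relaxed_proj \<alpha>\<^sub>2 C (relaxed_proj \<alpha>\<^sub>1 {z. A z = b} x) = x" for x
    unfolding proj_linear_part_eq_0_iff[OF assms(4,8)] right_minus_eq by (rule eq_commute)
  finally show ?thesis
    by (rule Collect_cong)
qed

end
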